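(* Let $\epsilon\in\{1,-1\}$, $\boldsymbol A\cdot\boldsymbol B=A_0B_0+\epsilon(A_1B_1+A_2B_2)$ on $\mathbb R^3$, and let $U,V:\mathbb Z\to\mathbb R$ satisfy $U(m_1)+V(m_2)>0$ for all $(m_1,m_2)\in\mathbb Z^2$. Let $\boldsymbol N:\mathbb Z^2\to\mathbb R^3$ be a solution of the discrete Bianchi--Ernst system with data $(U,V)$, let $\boldsymbol N^{(1)}$ be an upper-sign transform of $\boldsymbol N$ with transformation parameter $k^1$, and let $\boldsymbol N^{(2)}$ be a lower-sign transform of $\boldsymbol N$ with transformation parameter $k^2$, and suppose $(\boldsymbol N^{(1)}+\boldsymbol N^{(2)})\cdot(\boldsymbol N^{(1)}+\boldsymbol N^{(2)})$ is nowhere zero. Then there exists a unique solution $\boldsymbol N^{(12)}$ of the discrete Bianchi--Ernst system with data $(U,V)$, given in algebraic terms by $$\boldsymbol N^{(12)}=-\boldsymbol N+\frac{k^1+k^2}{(\boldsymbol N^{(1)}+\boldsymbol N^{(2)})\cdot(\boldsymbol N^{(1)}+\boldsymbol N^{(2)})}\,(\boldsymbol N^{(1)}+\boldsymbol N^{(2)}),$$ which is simultaneously a lower-sign transform of $\boldsymbol N^{(1)}$ with transformation parameter $k^2$ and an upper-sign transform of $\boldsymbol N^{(2)}$ with transformation parameter $k^1$.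
   Context: Lower bracketed subscripts denote shifts: $g_{(1)}(m_1,m_2)=g(m_1+1,m_2)$, $g_{(2)}(m_1,m_2)=g(m_1,m_2+1)$, $g_{(12)}(m_1,m_2)=g(m_1+1,m_2+1)$. Upper bracketed indices $\boldsymbol N^{(1)},\boldsymbol N^{(2)},\boldsymbol N^{(12)}$ merely label transforms; $k^1,k^2$ are two real constants (the superscripts are indices, not powers). A solution of the discrete Bianchi--Ernst system with data $(U,V)$ is a map $\boldsymbol N:\mathbb Z^2\to\mathbb R^3$ such that, for some $F:\mathbb Z^2\to\mathbb R$, $$\boldsymbol N_{(12)}+\boldsymbol N=F(\boldsymbol N_{(1)}+\boldsymbol N_{(2)}),\qquad(\boldsymbol N_{(12)}+\boldsymbol N)\cdot(\boldsymbol N_{(1)}+\boldsymbol N_{(2)})=U(m_1)+V(m_2).$$ Let $\boldsymbol N$ be such a solution with potential $F$, and let $k\in\mathbb R$ be such that $U(m_1)\mp k$ and $V(m_2)\pm k$ are nowhere zero. An upper-sign (respectively lower-sign) transform of $\boldsymbol N$ with transformation parameter $k$ is a solution $\boldsymbol N':\mathbb Z^2\to\mathbb R^3$ of the discrete Bianchi--Ernst system with the same data $(U,V)$ for which there is a nowhere vanishing scalar function $\Theta:\mathbb Z^2\to\mathbb R$ with $\Theta_{(12)}+\Theta=F(\Theta_{(1)}+\Theta_{(2)})$ such that, with all upper (respectively all lower) signs, $$\boldsymbol N'_{(1)}\mp\boldsymbol N=\frac{\Theta}{\Theta_{(1)}}(\boldsymbol N'\mp\boldsymbol N_{(1)}),\qquad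 \boldsymbol N'_{(2)}\pm\boldsymbol N=\frac{\Theta}{\Theta_{(2)}}(\boldsymbol N'\pm\boldsymbol N_{(2)}),$$ $$(\boldsymbol N'_{(1)}\mp\boldsymbol N)\cdot(\boldsymbol N'\mp\boldsymbol N_{(1)})=U(m_1)\mp k,\qquad(\boldsymbol N'_{(2)}\pm\boldsymbol N)\cdot(\boldsymbol N'\pm\boldsymbol N_{(2)})=V(m_2)\pm k.$$
   Formalization: Uniqueness is stated only among solutions given by the displayed formula; uniqueness among all simultaneous transforms is false: for ε=1, U=V=2, k^1=k^2=0, N=(1,0,0), N^(1)=N^(2)=(0,1,0), both N and -N qualify. *)

theory Defs
  imports "HOL-Analysis.Analysis"
begin

text \<open>The vector components \<open>A\<^sub>0, A\<^sub>1, A\<^sub>2\<close> are \<open>A $ 1, A $ 2, A $ 3\<close>.\<close>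

definition idot :: "real \<Rightarrow> real ^ 3 \<Rightarrow> real ^ 3 \<Rightarrow> real" where
  "idot \<epsilon> A B = A $ 1 * B $ 1 + \<epsilon> * (A $ 2 * B $ 2 + A $ 3 * B $ 3)"

definition moutard ::
  "(int \<Rightarrow> int \<Rightarrow> real) \<Rightarrow> (int \<Rightarrow> int \<Rightarrow> 'a::real_vector) \<Rightarrow> bool" where
  "moutard F X \<longleftrightarrow> (\<forall>m1 m2.
     X (m1 + 1) (m2 + 1) + X m1 m2 = F m1 m2 *\<^sub>R (X (m1 + 1) m2 + X m1 (m2 + 1)))"

definition bianchi_ernst_pot ::
  "real \<Rightarrow> (int \<Rightarrow> real) \<Rightarrow> (int \<Rightarrow> real) \<Rightarrow> (int \<Rightarrow> int \<Rightarrow> real)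
     \<Rightarrow> (int \<Rightarrow> int \<Rightarrow> real ^ 3) \<Rightarrow> bool" where
  "bianchi_ernst_pot \<epsilon> U V F N \<longleftrightarrow> moutard F N \<and>
     (\<forall>m1 m2. idot \<epsilon> (N (m1 + 1) (m2 + 1) + N m1 m2) (N (m1 + 1) m2 + N m1 (m2 + 1))
              = U m1 + V m2)"

definition bianchi_ernst ::
  "real \<Rightarrow> (int \<Rightarrow> real) \<Rightarrow> (int \<Rightarrow> real) \<Rightarrow> (int \<Rightarrow> int \<Rightarrow> real ^ 3) \<Rightarrow> bool" where
  "bianchi_ernst \<epsilon> U V N \<longleftrightarrow> (\<exists>F. bianchi_ernst_pot \<epsilon> U V F N)"

text \<open>
  The sign \<open>s = 1\<close> selects all upper signs and \<open>s = -1\<close> all lower signs.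
  If \<open>U m1 + V m2\<close> is nowhere zero, then \<open>F\<close> is determined by \<open>N\<close>, so quantifying
  it existentially fixes the potential of \<open>N\<close>.
\<close>

definition be_transform ::
  "real \<Rightarrow> real \<Rightarrow> (int \<Rightarrow> real) \<Rightarrow> (int \<Rightarrow> real) \<Rightarrow> real
     \<Rightarrow> (int \<Rightarrow> int \<Rightarrow> real ^ 3) \<Rightarrow> (int \<Rightarrow> int \<Rightarrow> real ^ 3) \<Rightarrow> bool" where
  "be_transform s \<epsilon> U V k N N' \<longleftrightarrow>
     (\<forall>m1. U m1 - s * k \<noteq> 0) \<and> (\<forall>m2. V m2 + s * k \<noteq> 0) \<and>
     bianchi_ernst \<epsilon> U V N' \<and>
     (\<exists>F \<Theta>. bianchi_ernst_pot \<epsilon> U V F N \<and>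
        (\<forall>m1 m2. \<Theta> m1 m2 \<noteq> 0) \<and> moutard F \<Theta> \<and>
        (\<forall>m1 m2.
           N' (m1 + 1) m2 - s *\<^sub>R N m1 m2
             = (\<Theta> m1 m2 / \<Theta> (m1 + 1) m2) *\<^sub>R (N' m1 m2 - s *\<^sub>R N (m1 + 1) m2) \<and>
           N' m1 (m2 + 1) + s *\<^sub>R N m1 m2
             = (\<Theta> m1 m2 / \<Theta> m1 (m2 + 1)) *\<^sub>R (N' m1 m2 + s *\<^sub>R N m1 (m2 + 1)) \<and>
           idot \<epsilon> (N' (m1 + 1) m2 - s *\<^sub>R N m1 m2) (N' m1 m2 - s *\<^sub>R N (m1 + 1) m2)
             = U m1 - s * k \<and>
           idot \<epsilon> (N' m1 (m2 + 1) + s *\<^sub>R N m1 m2) (N' m1 m2 + s *\<^sub>R N m1 (m2 + 1))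
             = V m2 + s * k))"

abbreviation "upper_transform \<equiv> be_transform 1"
abbreviation "lower_transform \<equiv> be_transform (-1)"

end

theory Submission imports Defs begin

text \<open>
  Transforms are discrete Moutard transforms: if \<open>\<Theta>\<close> is the scalar solution underlying a transform
  of \<open>N\<close> with potential \<open>F\<close>, then the transform has potential
  \<open>F \<Theta>\<^bsub>(1)\<^esub> \<Theta>\<^bsub>(2)\<^esub> / (\<Theta> \<Theta>\<^bsub>(12)\<^esub>)\<close>, and the two inner product constraints along the edges
  already force its Bianchi-Ernst constraint. Let \<open>\<Theta>\<close> and \<open>\<Phi>\<close> belong to \<open>N\<^sup>1\<close> and \<open>N\<^sup>2\<close>,
  and put \<open>D = (N\<^sup>1 + N\<^sup>2) \<cdot> (N\<^sup>1 + N\<^sup>2)\<close>. The edge relations show that \<open>S = \<Theta> \<Phi> D\<close> is, up to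
  the factor \<open>k\<^sup>1 + k\<^sup>2\<close>, the bilinear potential of \<open>\<Theta>\<close> and \<open>\<Phi>\<close>. Hence \<open>S / \<Theta> = \<Phi> D\<close> and
  \<open>S / \<Phi> = \<Theta> D\<close> are scalar solutions for the potentials of \<open>N\<^sup>1\<close> and \<open>N\<^sup>2\<close>, and they
  serve for the two transforms leading to \<open>N\<^bsup>12\<^esup>\<close>. Reversing the sign \<open>s\<close> exchanges the roles
  of \<open>N\<^sup>1\<close> and \<open>N\<^sup>2\<close> as well as of the two lattice directions.
\<close>

section \<open>The inner product and the potential of a solution\<close>

lemma bilinear_idot: "bilinear (idot \<epsilon>)"
  by (auto simp: bilinear_def linear_iff idot_def algebra_simps)

lemmas idot_bilinear_simps =
  bilinear_ladd[OF bilinear_idot] bilinear_radd[OF bilinear_idot]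
  bilinear_lsub[OF bilinear_idot] bilinear_rsub[OF bilinear_idot]
  bilinear_lmul[OF bilinear_idot] bilinear_rmul[OF bilinear_idot]

lemma idot_commute: "idot \<epsilon> A B = idot \<epsilon> B A"
  by (simp add: idot_def mult.commute)

lemma bianchi_ernst_pot_norm:
  assumes "bianchi_ernst_pot \<epsilon> U V F N"
  shows "F m1 m2 * idot \<epsilon> (N (m1 + 1) m2 + N m1 (m2 + 1)) (N (m1 + 1) m2 + N m1 (m2 + 1))
    = U m1 + V m2"
proof -
  let ?d = "N (m1 + 1) m2 + N m1 (m2 + 1)"
  have "F m1 m2 * idot \<epsilon> ?d ?d = idot \<epsilon> (F m1 m2 *\<^sub>R ?d) ?d"
    by (simp only: bilinear_lmul[OF bilinear_idot] real_scaleR_def)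
  also have "F m1 m2 *\<^sub>R ?d = N (m1 + 1) (m2 + 1) + N m1 m2"
    using assms unfolding bianchi_ernst_pot_def moutard_def by simp
  also have "idot \<epsilon> \<dots> ?d = U m1 + V m2"
    using assms unfolding bianchi_ernst_pot_def by blast
  finally show ?thesis .
qed

text \<open>Both potentials multiply the same squared length to give the nonzero
  \<open>U m1 + V m2\<close>. Two transforms of \<open>N\<close> each bring their own existential
  potential; this identifies them.\<close>

lemma bianchi_ernst_pot_unique:
  assumes nz: "\<And>m1 m2. U m1 + V m2 \<noteq> 0"
    and F: "bianchi_ernst_pot \<epsilon> U V F N" and G: "bianchi_ernst_pot \<epsilon> U V G N"
  shows "F = G"
proof (intro ext)
  fix m1 m2
  show "F m1 m2 = G m1 m2"
    using bianchi_ernst_pot_norm[OF F, of m1 m2] bianchi_ernst_pot_norm[OF G, of m1 m2] nz[of m1 m2]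
    by (metis mult_cancel_right mult_zero_right)
qed

section \<open>Discrete Moutard transforms on one quadrilateral\<close>

text \<open>The scalar form puts the elimination within reach of \<open>algebra\<close>; it is
  applied to each vector component, with \<open>y12\<close> reached along the path through
  \<open>y1\<close>.\<close>

lemma moutard_quad_real:
  fixes s :: real
  assumes nz: "a \<noteq> 0" "a1 \<noteq> 0" "a2 \<noteq> 0" "a12 \<noteq> 0"
    and a: "a12 + a = F * (a1 + a2)" and n: "n12 + n = F * (n1 + n2)"
    and y1: "y1 - s * n = (a / a1) * (y - s * n1)"
    and y2: "y2 + s * n = (a / a2) * (y + s * n2)"
    and y12: "y12 + s * n1 = (a1 / a12) * (y1 + s * n12)"
  shows "y12 + y = (F * a1 * a2 / (a * a12)) * (y1 + y2)"
proof -
  have 1: "a1 * y1 = a * y - s * a * n1 + s * a1 * n"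
    and 2: "a2 * y2 = a * y + s * a * n2 - s * a2 * n"
    and 3: "a12 * y12 = a1 * y1 + s * a1 * n12 - s * a12 * n1"
    using y1 y2 y12 nz by (simp_all add: field_simps)
  have 4: "a1 * a2 * (y1 + y2) = a * (a1 + a2) * y + s * a * (a1 * n2 - a2 * n1)"
    using 1 2 by algebra
  \<comment> \<open>Adding \<open>1\<close> and \<open>3\<close> pairs \<open>n12\<close> with
    \<open>n\<close> and \<open>a12\<close> with \<open>a\<close>. Both Moutard equations then apply
    and leave the cross term that also occurs in \<open>4\<close>.\<close>
  have "a12 * y12 = a * y + s * F * (a1 * n2 - a2 * n1)"
    using 1 3 a n by algebra
  hence "a * (a12 * (y12 + y)) = F * (a1 * a2 * (y1 + y2))"
    unfolding 4 using a by algebra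
  thus ?thesis using nz by (simp add: field_simps)
qed

text \<open>The constraint for \<open>N'\<close> is quadratic in the edge vectors \<open>X\<close>
  and \<open>Y\<close>. Their squared lengths come from the edge constraints, and their mixed
  product from the constraint for \<open>N\<close>, since \<open>Y - X\<close> is \<open>s\<close>
  times a diagonal sum of \<open>N\<close>.\<close>

lemma bianchi_ernst_pot_transform:
  fixes s k :: real
  assumes s: "s\<^sup>2 = 1" and N: "bianchi_ernst_pot \<epsilon> U V F N"
    and nz: "\<And>m1 m2. \<Theta> m1 m2 \<noteq> 0" and \<Theta>: "moutard F \<Theta>"
    and N'1: "\<And>m1 m2. N' (m1 + 1) m2 - s *\<^sub>R N m1 m2
             = (\<Theta> m1 m2 / \<Theta> (m1 + 1) m2) *\<^sub>R (N' m1 m2 - s *\<^sub>R N (m1 + 1) m2)"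
    and N'2: "\<And>m1 m2. N' m1 (m2 + 1) + s *\<^sub>R N m1 m2
             = (\<Theta> m1 m2 / \<Theta> m1 (m2 + 1)) *\<^sub>R (N' m1 m2 + s *\<^sub>R N m1 (m2 + 1))"
    and U: "\<And>m1 m2. idot \<epsilon> (N' (m1 + 1) m2 - s *\<^sub>R N m1 m2)
              (N' m1 m2 - s *\<^sub>R N (m1 + 1) m2) = U m1 - s * k"
    and V: "\<And>m1 m2. idot \<epsilon> (N' m1 (m2 + 1) + s *\<^sub>R N m1 m2)
              (N' m1 m2 + s *\<^sub>R N m1 (m2 + 1)) = V m2 + s * k"
  shows "bianchi_ernst_pot \<epsilon> U V
    (\<lambda>m1 m2. F m1 m2 * \<Theta> (m1 + 1) m2 * \<Theta> m1 (m2 + 1) / (\<Theta> m1 m2 * \<Theta> (m1 + 1) (m2 + 1))) N'"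
    (is "bianchi_ernst_pot \<epsilon> U V ?F' N'")
proof -
  have N_eq: "N (m1 + 1) (m2 + 1) + N m1 m2 = F m1 m2 *\<^sub>R (N (m1 + 1) m2 + N m1 (m2 + 1))"
    for m1 m2 using N unfolding bianchi_ernst_pot_def moutard_def by blast
  have \<Theta>_eq: "\<Theta> (m1 + 1) (m2 + 1) + \<Theta> m1 m2 = F m1 m2 * (\<Theta> (m1 + 1) m2 + \<Theta> m1 (m2 + 1))"
    for m1 m2 using \<Theta> unfolding moutard_def by simp
  have M: "N' (m1 + 1) (m2 + 1) + N' m1 m2 = ?F' m1 m2 *\<^sub>R (N' (m1 + 1) m2 + N' m1 (m2 + 1))"
    for m1 m2
    unfolding vec_eq_iff
  proof
    fix i
    show "(N' (m1 + 1) (m2 + 1) + N' m1 m2) $ i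
        = (?F' m1 m2 *\<^sub>R (N' (m1 + 1) m2 + N' m1 (m2 + 1))) $ i"
      using moutard_quad_real[OF nz nz nz nz \<Theta>_eq[of m1 m2],
          of "N (m1 + 1) (m2 + 1) $ i" "N m1 m2 $ i" "N (m1 + 1) m2 $ i" "N m1 (m2 + 1) $ i"
             "N' (m1 + 1) m2 $ i" s "N' m1 m2 $ i" "N' m1 (m2 + 1) $ i" "N' (m1 + 1) (m2 + 1) $ i"]
        arg_cong[OF N_eq[of m1 m2], of "\<lambda>v. v $ i"]
        arg_cong[OF N'1[of m1 m2], of "\<lambda>v. v $ i"]
        arg_cong[OF N'2[of m1 m2], of "\<lambda>v. v $ i"]
        arg_cong[OF N'2[of "m1 + 1" m2], of "\<lambda>v. v $ i"]
      by simp
  qed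
  have "idot \<epsilon> (N' (m1 + 1) (m2 + 1) + N' m1 m2) (N' (m1 + 1) m2 + N' m1 (m2 + 1))
      = U m1 + V m2" for m1 m2
  proof -
    define a where "a = \<Theta> m1 m2"
    define a1 where "a1 = \<Theta> (m1 + 1) m2"
    define a2 where "a2 = \<Theta> m1 (m2 + 1)"
    define a12 where "a12 = \<Theta> (m1 + 1) (m2 + 1)"
    define f where "f = F m1 m2"
    define X where "X = N' m1 m2 - s *\<^sub>R N (m1 + 1) m2"
    define Y where "Y = N' m1 m2 + s *\<^sub>R N m1 (m2 + 1)"
    note defs = a_def a1_def a2_def a12_def f_def X_def Y_def
    have nzs: "a \<noteq> 0" "a1 \<noteq> 0" "a2 \<noteq> 0" "a12 \<noteq> 0" using nz by (auto simp: defs)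
    have a: "a12 + a = f * (a1 + a2)" using \<Theta>_eq by (simp add: defs)
    have XX: "idot \<epsilon> X X = a1 / a * (U m1 - s * k)"
      using U[of m1 m2] nzs unfolding N'1 X_def[symmetric] a_def[symmetric] a1_def[symmetric]
      by (simp add: idot_bilinear_simps field_simps)
    have YY: "idot \<epsilon> Y Y = a2 / a * (V m2 + s * k)"
      using V[of m1 m2] nzs unfolding N'2 Y_def[symmetric] a_def[symmetric] a2_def[symmetric]
      by (simp add: idot_bilinear_simps field_simps)
    let ?d = "N (m1 + 1) m2 + N m1 (m2 + 1)"
    have d: "f * idot \<epsilon> ?d ?d = U m1 + V m2"
      using bianchi_ernst_pot_norm[OF N] by (simp add: f_def)
    have "Y - X = s *\<^sub>R ?d" by (simp add: defs algebra_simps)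
    hence "idot \<epsilon> (Y - X) (Y - X) = s\<^sup>2 * idot \<epsilon> ?d ?d"
      by (simp only: idot_bilinear_simps(5,6)) (simp add: power2_eq_square)
    hence "f * idot \<epsilon> (Y - X) (Y - X) = U m1 + V m2" using d s by simp
    hence XY: "f * (idot \<epsilon> X X + idot \<epsilon> Y Y - 2 * idot \<epsilon> X Y) = U m1 + V m2"
      by (simp add: idot_bilinear_simps idot_commute[of \<epsilon> Y X] algebra_simps)
    have "N' (m1 + 1) m2 + N' m1 (m2 + 1) = (a / a1) *\<^sub>R X + (a / a2) *\<^sub>R Y"
      using N'1[of m1 m2] N'2[of m1 m2] unfolding defs
      by (metis (no_types, lifting) add.commute add_diff_eq diff_add_cancel)
    hence "idot \<epsilon> (N' (m1 + 1) (m2 + 1) + N' m1 m2) (N' (m1 + 1) m2 + N' m1 (m2 + 1))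
       = f * a1 * a2 / (a * a12) *
          idot \<epsilon> ((a / a1) *\<^sub>R X + (a / a2) *\<^sub>R Y) ((a / a1) *\<^sub>R X + (a / a2) *\<^sub>R Y)"
      unfolding M by (simp add: bilinear_lmul[OF bilinear_idot] defs)
    also have "\<dots> = f * a / (a12 * a1 * a2) *
         (a2\<^sup>2 * idot \<epsilon> X X + a1\<^sup>2 * idot \<epsilon> Y Y + 2 * a1 * a2 * idot \<epsilon> X Y)"
      using nzs by (simp add: idot_bilinear_simps idot_commute[of \<epsilon> Y X] field_simps power2_eq_square)
    \<comment> \<open>Eliminating the mixed product by \<open>XY\<close> makes the quadratic form
      split off the factor \<open>a1 + a2\<close>.\<close>
    also have "\<dots> = a / (a12 * a1 * a2) *
         (f * (a1 + a2) * (a2 * idot \<epsilon> X X + a1 * idot \<epsilon> Y Y) - a1 * a2 * (U m1 + V m2))"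
      unfolding XY[symmetric] by (simp add: algebra_simps power2_eq_square)
    \<comment> \<open>Here the contributions of \<open>k\<close> from the two edges cancel.\<close>
    also have "a2 * idot \<epsilon> X X + a1 * idot \<epsilon> Y Y = a1 * a2 / a * (U m1 + V m2)"
      unfolding XX YY using nzs by (simp add: field_simps)
    also have "a / (a12 * a1 * a2) *
         (f * (a1 + a2) * (a1 * a2 / a * (U m1 + V m2)) - a1 * a2 * (U m1 + V m2))
         = (f * (a1 + a2) - a) / a12 * (U m1 + V m2)"
      using nzs by (simp add: field_simps)
    also have "\<dots> = U m1 + V m2" using nzs by (simp flip: a)
    finally show ?thesis .
  qed
  with M show ?thesis unfolding bianchi_ernst_pot_def moutard_def by blast
qed

section \<open>Superposition of two transforms\<close>

text \<open>A single edge suffices: direction 1 has \<open>u = U m1\<close>, and direction 2 follows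
  with \<open>u = V m2\<close> and the sign \<open>s\<close> reversed. Everything is expanded in
  \<open>X\<close> and \<open>Y\<close>, and their unknown mixed product is traded for
  \<open>D\<close>.\<close>

lemma superposition_edge:
  fixes n n' a a' b b' :: "real ^ 3" and s k l u :: real
  assumes s: "s\<^sup>2 = 1" and nz: "\<theta> \<noteq> 0" "\<theta>' \<noteq> 0" "\<phi> \<noteq> 0" "\<phi>' \<noteq> 0"
    and a: "a' - s *\<^sub>R n = (\<theta> / \<theta>') *\<^sub>R (a - s *\<^sub>R n')"
      "idot \<epsilon> (a' - s *\<^sub>R n) (a - s *\<^sub>R n') = u - s * k"
    and b: "b' + s *\<^sub>R n = (\<phi> / \<phi>') *\<^sub>R (b + s *\<^sub>R n')"
      "idot \<epsilon> (b' + s *\<^sub>R n) (b + s *\<^sub>R n') = u + s * l"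
    and D: "D = idot \<epsilon> (a + b) (a + b)" "D \<noteq> 0"
    and D': "D' = idot \<epsilon> (a' + b') (a' + b')" "D' \<noteq> 0"
    and c: "c = - n + ((k + l) / D) *\<^sub>R (a + b)"
    and c': "c' = - n' + ((k + l) / D') *\<^sub>R (a' + b')"
  shows "\<theta>' * \<phi>' * D' - \<theta> * \<phi> * D = s * (k + l) * (\<theta>' * \<phi> - \<theta> * \<phi>')" (is ?S)
    and "c' + s *\<^sub>R a = (\<phi> * D / (\<phi>' * D')) *\<^sub>R (c + s *\<^sub>R a')" (is ?C)
    and "idot \<epsilon> (c' + s *\<^sub>R a) (c + s *\<^sub>R a') = u + s * l" (is ?I)
proof -
  define p q where "p = \<theta>' / \<theta>" and "q = \<phi>' / \<phi>"
  have nz': "p \<noteq> 0" "q \<noteq> 0" using nz by (auto simp: p_def q_def)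
  define X where "X = a - s *\<^sub>R n'"
  define Y where "Y = b + s *\<^sub>R n'"
  have ss: "s * s = 1" using s by (simp add: power2_eq_square)
  have X': "a' - s *\<^sub>R n = (1 / p) *\<^sub>R X" and Y': "b' + s *\<^sub>R n = (1 / q) *\<^sub>R Y"
    using a(1) b(1) by (simp_all add: p_def q_def X_def Y_def)
  have XX: "idot \<epsilon> X X = p * (u - s * k)" and YY: "idot \<epsilon> Y Y = q * (u + s * l)"
    using a(2) b(2) nz' unfolding X' Y' X_def[symmetric] Y_def[symmetric]
    by (simp_all add: idot_bilinear_simps field_simps)
  have ab: "a + b = X + Y" by (simp add: X_def Y_def)
  have ab': "a' + b' = (1 / p) *\<^sub>R X + (1 / q) *\<^sub>R Y" 
    unfolding X'[symmetric] Y'[symmetric] by simp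
  have D_eq: "D = p * (u - s * k) + q * (u + s * l) + 2 * idot \<epsilon> X Y"
    unfolding D(1) ab by (simp add: idot_bilinear_simps idot_commute[of \<epsilon> Y X] XX YY)
  have D'_eq: "p * q * D' = q * (u - s * k) + p * (u + s * l) + 2 * idot \<epsilon> X Y"
    unfolding D'(1) ab' using nz'
    by (simp add: idot_bilinear_simps idot_commute[of \<epsilon> Y X] XX YY field_simps)
  \<comment> \<open>The mixed product is the same in both expansions and cancels; multiplying by
    \<open>\<theta> * \<phi>\<close> gives the increment of the bilinear potential.\<close>
  have DD: "p * q * D' = D + s * (k + l) * (p - q)"
    unfolding D_eq D'_eq by (simp add: algebra_simps)
  have "\<theta>' = p * \<theta>" "\<phi>' = q * \<phi>" using nz by (simp_all add: p_def q_def)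
  thus ?S using DD by algebra
  have ca: "c + s *\<^sub>R a' = s *\<^sub>R ((1 / p) *\<^sub>R X) + ((k + l) / D) *\<^sub>R (X + Y)"
    unfolding X'[symmetric] c ab by (simp add: scaleR_right_diff_distrib ss)
  have ca': "c' + s *\<^sub>R a = s *\<^sub>R X + ((k + l) / D') *\<^sub>R ((1 / p) *\<^sub>R X + (1 / q) *\<^sub>R Y)"
    unfolding c' ab' by (simp add: X_def scaleR_right_diff_distrib ss)
  \<comment> \<open>\<open>coX\<close> and \<open>coY\<close> compare the coefficients of
    \<open>X\<close> and \<open>Y\<close> on the two sides of the edge relation for
    \<open>c\<close>.\<close>
  have coX: "s + (k + l) / D' / p = D / (q * D') * (s / p + (k + l) / D)"
  proof -
    have "s * (p * q * D') + (k + l) * q = s * D + (k + l) * p"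
      unfolding DD using ss by algebra
    thus ?thesis using nz' D(2) D'(2) by (simp add: field_simps)
  qed
  have coY: "(k + l) / D' / q = D / (q * D') * ((k + l) / D)"
    using D(2) by simp
  have C: "c' + s *\<^sub>R a = (D / (q * D')) *\<^sub>R (c + s *\<^sub>R a')"
  proof -
    have "c' + s *\<^sub>R a = (s + (k + l) / D' / p) *\<^sub>R X + ((k + l) / D' / q) *\<^sub>R Y"
      unfolding ca' by (simp add: algebra_simps)
    also have "\<dots> = (D / (q * D')) *\<^sub>R (c + s *\<^sub>R a')"
      unfolding ca coX coY by (simp only: scaleR_scaleR[symmetric] scaleR_add_left scaleR_add_right)
        (simp add: algebra_simps)
    finally show ?thesis .
  qed
  have "\<phi> * D / (\<phi>' * D') = D / (q * D')" using nz by (simp add: q_def)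
  with C show ?C by simp
  \<comment> \<open>By \<open>C\<close> the two vectors in the inner product are parallel, so one
    squared length decides it.\<close>
  have "idot \<epsilon> (c + s *\<^sub>R a') (c + s *\<^sub>R a')
      = (s * s) * idot \<epsilon> X X / p\<^sup>2 + s * (k + l) / (p * D) * (2 * idot \<epsilon> X X + 2 * idot \<epsilon> X Y)
        + ((k + l) / D)\<^sup>2 * D"
    unfolding ca D(1) ab
    by (simp add: idot_bilinear_simps idot_commute[of \<epsilon> Y X] algebra_simps power2_eq_square add_divide_distrib)
  also have "2 * idot \<epsilon> X X + 2 * idot \<epsilon> X Y = D + p * (u - s * k) - q * (u + s * l)"
    unfolding D_eq XX by simp
  also have "(s * s) * idot \<epsilon> X X / p\<^sup>2 + s * (k + l) / (p * D) * (D + p * (u - s * k) - q * (u + s * l))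
        + ((k + l) / D)\<^sup>2 * D
      = (D * (u - s * k) + s * (k + l) * (D + p * (u - s * k) - q * (u + s * l)) + p * (k + l)\<^sup>2) / (p * D)"
    unfolding ss XX using nz' D(2) by (simp add: field_simps power2_eq_square)
  also have "D * (u - s * k) + s * (k + l) * (D + p * (u - s * k) - q * (u + s * l)) + p * (k + l)\<^sup>2
      = (u + s * l) * (D + s * (k + l) * (p - q))"
    using ss by algebra
  also have "\<dots> / (p * D) = (u + s * l) * (q * D') / D"
    unfolding DD[symmetric] using nz' by simp
  finally show ?I unfolding C using nz' D(2) D'(2) by (simp add: bilinear_lmul[OF bilinear_idot])
qed

text \<open>\<open>S\<close> is a bilinear potential of \<open>\<Theta>\<close> and
  \<open>\<Phi>\<close>, and \<open>S / \<Theta>\<close> is the Moutard transform of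
  \<open>\<Phi>\<close> generated by \<open>\<Theta>\<close>. The opposite signs of \<open>c\<close>
  in the two directions make the increments compatible.\<close>

lemma moutard_superposition:
  assumes nz: "\<And>m1 m2. \<Theta> m1 m2 \<noteq> 0"
    and \<Theta>: "moutard F \<Theta>" and \<Phi>: "moutard F (\<Phi> :: int \<Rightarrow> int \<Rightarrow> real)"
    and S1: "\<And>m1 m2. S (m1 + 1) m2 - S m1 m2 = c * (\<Theta> (m1 + 1) m2 * \<Phi> m1 m2 - \<Theta> m1 m2 * \<Phi> (m1 + 1) m2)"
    and S2: "\<And>m1 m2. S m1 (m2 + 1) - S m1 m2 = - c * (\<Theta> m1 (m2 + 1) * \<Phi> m1 m2 - \<Theta> m1 m2 * \<Phi> m1 (m2 + 1))"
  shows "moutard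
    (\<lambda>m1 m2. F m1 m2 * \<Theta> (m1 + 1) m2 * \<Theta> m1 (m2 + 1) / (\<Theta> m1 m2 * \<Theta> (m1 + 1) (m2 + 1)))
    (\<lambda>m1 m2. S m1 m2 / \<Theta> m1 m2)"
  unfolding moutard_def
proof (intro allI)
  fix m1 m2
  define a where "a = \<Theta> m1 m2"
  define a1 where "a1 = \<Theta> (m1 + 1) m2"
  define a2 where "a2 = \<Theta> m1 (m2 + 1)"
  define a12 where "a12 = \<Theta> (m1 + 1) (m2 + 1)"
  define b where "b = \<Phi> m1 m2"
  define b1 where "b1 = \<Phi> (m1 + 1) m2"
  define b2 where "b2 = \<Phi> m1 (m2 + 1)"
  define b12 where "b12 = \<Phi> (m1 + 1) (m2 + 1)"
  define t where "t = S m1 m2"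
  define t1 where "t1 = S (m1 + 1) m2"
  define t2 where "t2 = S m1 (m2 + 1)"
  define t12 where "t12 = S (m1 + 1) (m2 + 1)"
  define f where "f = F m1 m2"
  note defs = a_def a1_def a2_def a12_def b_def b1_def b2_def b12_def t_def t1_def t2_def t12_def f_def
  have nzs: "a \<noteq> 0" "a1 \<noteq> 0" "a2 \<noteq> 0" "a12 \<noteq> 0" using nz by (auto simp: defs)
  have e: "a12 + a = f * (a1 + a2)" "b12 + b = f * (b1 + b2)"
    using \<Theta> \<Phi> unfolding moutard_def defs by auto
  have t: "t1 - t = c * (a1 * b - a * b1)" "t2 - t = - c * (a2 * b - a * b2)"
    "t12 - t1 = - c * (a12 * b1 - a1 * b12)"
    using S1[of m1 m2] S2[of m1 m2] S2[of "m1 + 1" m2] unfolding defs by simp_all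
  \<comment> \<open>This is the Moutard equation for \<open>S / \<Theta>\<close> with denominators
    cleared; \<open>t12\<close> is reached through \<open>t1\<close>.\<close>
  have "a * t12 + a12 * t = f * (a2 * t1 + a1 * t2)" using e t by algebra
  hence "t12 / a12 + t / a = f * a1 * a2 / (a * a12) * (t1 / a1 + t2 / a2)"
    using nzs by (simp add: field_simps)
  thus "S (m1 + 1) (m2 + 1) / \<Theta> (m1 + 1) (m2 + 1) + S m1 m2 / \<Theta> m1 m2 =
     (F m1 m2 * \<Theta> (m1 + 1) m2 * \<Theta> m1 (m2 + 1) / (\<Theta> m1 m2 * \<Theta> (m1 + 1) (m2 + 1))) *\<^sub>R
       (S (m1 + 1) m2 / \<Theta> (m1 + 1) m2 + S m1 (m2 + 1) / \<Theta> m1 (m2 + 1))"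
    unfolding defs by simp
qed

text \<open>The formula for the new solution is symmetric under exchanging \<open>A\<close> with
  \<open>B\<close> and \<open>k\<close> with \<open>l\<close>, so the two choices of
  \<open>s\<close> yield both transforms of the theorem.\<close>

lemma be_transform_superposition:
  fixes s k l :: real
  assumes s: "s\<^sup>2 = 1" and UV: "\<And>m1 m2. U m1 + V m2 \<noteq> 0"
    and A: "be_transform s \<epsilon> U V k N A" and B: "be_transform (- s) \<epsilon> U V l N B"
    and D: "\<And>m1 m2. idot \<epsilon> (A m1 m2 + B m1 m2) (A m1 m2 + B m1 m2) \<noteq> 0"
  shows "be_transform (- s) \<epsilon> U V l A (\<lambda>m1 m2. - N m1 m2 +
       ((k + l) / idot \<epsilon> (A m1 m2 + B m1 m2) (A m1 m2 + B m1 m2))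
         *\<^sub>R (A m1 m2 + B m1 m2))" (is "be_transform _ _ _ _ _ _ ?C")
proof -
  obtain F \<Theta> where F: "bianchi_ernst_pot \<epsilon> U V F N" 
    and \<Theta>: "\<And>m1 m2. \<Theta> m1 m2 \<noteq> 0" "moutard F \<Theta>"
    and A': "\<And>m1 m2. A (m1 + 1) m2 - s *\<^sub>R N m1 m2
             = (\<Theta> m1 m2 / \<Theta> (m1 + 1) m2) *\<^sub>R (A m1 m2 - s *\<^sub>R N (m1 + 1) m2)"
      "\<And>m1 m2. A m1 (m2 + 1) + s *\<^sub>R N m1 m2
             = (\<Theta> m1 m2 / \<Theta> m1 (m2 + 1)) *\<^sub>R (A m1 m2 + s *\<^sub>R N m1 (m2 + 1))"
      "\<And>m1 m2. idot \<epsilon> (A (m1 + 1) m2 - s *\<^sub>R N m1 m2)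
              (A m1 m2 - s *\<^sub>R N (m1 + 1) m2) = U m1 - s * k"
      "\<And>m1 m2. idot \<epsilon> (A m1 (m2 + 1) + s *\<^sub>R N m1 m2)
              (A m1 m2 + s *\<^sub>R N m1 (m2 + 1)) = V m2 + s * k"
    using A unfolding be_transform_def by blast
  obtain G \<Phi> where G: "bianchi_ernst_pot \<epsilon> U V G N" 
    and \<Phi>: "\<And>m1 m2. \<Phi> m1 m2 \<noteq> 0" "moutard G \<Phi>"
    and B0: "\<And>m1 m2. B (m1 + 1) m2 - (- s) *\<^sub>R N m1 m2
             = (\<Phi> m1 m2 / \<Phi> (m1 + 1) m2) *\<^sub>R (B m1 m2 - (- s) *\<^sub>R N (m1 + 1) m2)"
      "\<And>m1 m2. B m1 (m2 + 1) + (- s) *\<^sub>R N m1 m2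
             = (\<Phi> m1 m2 / \<Phi> m1 (m2 + 1)) *\<^sub>R (B m1 m2 + (- s) *\<^sub>R N m1 (m2 + 1))"
      "\<And>m1 m2. idot \<epsilon> (B (m1 + 1) m2 - (- s) *\<^sub>R N m1 m2)
              (B m1 m2 - (- s) *\<^sub>R N (m1 + 1) m2) = U m1 - (- s) * l"
      "\<And>m1 m2. idot \<epsilon> (B m1 (m2 + 1) + (- s) *\<^sub>R N m1 m2)
              (B m1 m2 + (- s) *\<^sub>R N m1 (m2 + 1)) = V m2 + (- s) * l"
    using B unfolding be_transform_def by blast
  have sign: "x - (- s) *\<^sub>R y = x + s *\<^sub>R y" "c - (- s) * r = c + s * r"
    for x y :: "real ^ 3" and c r by simp_all
  note B' = B0(1,3)[unfolded sign]
  \<comment> \<open>Relations in direction 2 take the shape of those in direction 1 once the sign is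
    \<open>- s\<close>, as the edge lemma requires.\<close>
  have A'': "A m1 (m2 + 1) - (- s) *\<^sub>R N m1 m2
             = (\<Theta> m1 m2 / \<Theta> m1 (m2 + 1)) *\<^sub>R (A m1 m2 - (- s) *\<^sub>R N m1 (m2 + 1))"
      "idot \<epsilon> (A m1 (m2 + 1) - (- s) *\<^sub>R N m1 m2)
              (A m1 m2 - (- s) *\<^sub>R N m1 (m2 + 1)) = V m2 - (- s) * k" for m1 m2
    unfolding sign by (rule A'(2,4))+
  have GF: "G = F" using bianchi_ernst_pot_unique[OF UV G F] .
  let ?D = "\<lambda>m1 m2. idot \<epsilon> (A m1 m2 + B m1 m2) (A m1 m2 + B m1 m2)"
  let ?S = "\<lambda>m1 m2. \<Theta> m1 m2 * \<Phi> m1 m2 * ?D m1 m2"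
  let ?\<Psi> = "\<lambda>m1 m2. \<Phi> m1 m2 * ?D m1 m2"
  let ?F' = "\<lambda>m1 m2. F m1 m2 * \<Theta> (m1 + 1) m2 * \<Theta> m1 (m2 + 1) / (\<Theta> m1 m2 * \<Theta> (m1 + 1) (m2 + 1))"
  have s': "(- s)\<^sup>2 = 1" using s by simp
  note edge1 = superposition_edge[OF s \<Theta>(1) \<Theta>(1) \<Phi>(1) \<Phi>(1) A'(1) A'(3)
      B' refl D refl D refl refl]
  note edge2 = superposition_edge[OF s' \<Theta>(1) \<Theta>(1) \<Phi>(1) \<Phi>(1) A''
      B0(2,4) refl D refl D refl refl]
  have S: "moutard ?F' (\<lambda>m1 m2. ?S m1 m2 / \<Theta> m1 m2)"
  proof (rule moutard_superposition[OF \<Theta> \<Phi>(2)[unfolded GF]])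
    show "?S (m1 + 1) m2 - ?S m1 m2
        = s * (k + l) * (\<Theta> (m1 + 1) m2 * \<Phi> m1 m2 - \<Theta> m1 m2 * \<Phi> (m1 + 1) m2)" for m1 m2
      by (rule edge1(1))
    show "?S m1 (m2 + 1) - ?S m1 m2
        = - (s * (k + l)) * (\<Theta> m1 (m2 + 1) * \<Phi> m1 m2 - \<Theta> m1 m2 * \<Phi> m1 (m2 + 1))" for m1 m2
      using edge2(1)[of m1 m2] by simp
  qed
  have \<Psi>: "moutard ?F' ?\<Psi>" using S \<Theta>(1) by (simp add: mult.assoc)
  have \<Psi>_nz: "?\<Psi> m1 m2 \<noteq> 0" for m1 m2 using \<Phi>(1) D by simp
  have C: "?C (m1 + 1) m2 - (- s) *\<^sub>R A m1 m2
             = (?\<Psi> m1 m2 / ?\<Psi> (m1 + 1) m2) *\<^sub>R (?C m1 m2 - (- s) *\<^sub>R A (m1 + 1) m2)"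
      "?C m1 (m2 + 1) + (- s) *\<^sub>R A m1 m2
             = (?\<Psi> m1 m2 / ?\<Psi> m1 (m2 + 1)) *\<^sub>R (?C m1 m2 + (- s) *\<^sub>R A m1 (m2 + 1))"
      "idot \<epsilon> (?C (m1 + 1) m2 - (- s) *\<^sub>R A m1 m2)
              (?C m1 m2 - (- s) *\<^sub>R A (m1 + 1) m2) = U m1 - (- s) * l"
      "idot \<epsilon> (?C m1 (m2 + 1) + (- s) *\<^sub>R A m1 m2)
              (?C m1 m2 + (- s) *\<^sub>R A m1 (m2 + 1)) = V m2 + (- s) * l" for m1 m2
    unfolding sign by (rule edge1(2) edge1(3) edge2(2) edge2(3))+
  have A_pot: "bianchi_ernst_pot \<epsilon> U V ?F' A"
    by (rule bianchi_ernst_pot_transform[OF s F \<Theta> A'])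
  \<comment> \<open>The transform lemma is used a second time, now starting from \<open>A\<close>
    with the scalar solution \<open>?\<Psi>\<close>.\<close>
  have C_be: "bianchi_ernst \<epsilon> U V ?C"
    unfolding bianchi_ernst_def
    using bianchi_ernst_pot_transform[OF s' A_pot \<Psi>_nz \<Psi> C] by blast
  have nz: "U m1 - (- s) * l \<noteq> 0" "V m2 + (- s) * l \<noteq> 0" for m1 m2
    using B unfolding be_transform_def by blast+
  show ?thesis
    unfolding be_transform_def
    by (intro conjI allI nz C_be, rule exI[of _ ?F'], rule exI[of _ ?\<Psi>])
      (intro conjI allI A_pot \<Psi>_nz \<Psi> C)
qed

theorem theorem9:
  fixes \<epsilon> k1 k2 :: real
    and U V :: "int \<Rightarrow> real"
    and N N1 N2 :: "int \<Rightarrow> int \<Rightarrow> real ^ 3"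
  assumes "\<epsilon> \<in> {1, -1}"
    and "\<And>m1 m2. U m1 + V m2 > 0"
    and "bianchi_ernst \<epsilon> U V N"
    and "upper_transform \<epsilon> U V k1 N N1"
    and "lower_transform \<epsilon> U V k2 N N2"
    and "\<And>m1 m2. idot \<epsilon> (N1 m1 m2 + N2 m1 m2) (N1 m1 m2 + N2 m1 m2) \<noteq> 0"
  shows "\<exists>!N12. bianchi_ernst \<epsilon> U V N12 \<and>
    (\<forall>m1 m2. N12 m1 m2 = - N m1 m2 +
       ((k1 + k2) / idot \<epsilon> (N1 m1 m2 + N2 m1 m2) (N1 m1 m2 + N2 m1 m2))
         *\<^sub>R (N1 m1 m2 + N2 m1 m2)) \<and>
    lower_transform \<epsilon> U V k2 N1 N12 \<and>
    upper_transform \<epsilon> U V k1 N2 N12"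
proof -
  let ?C = "\<lambda>m1 m2. - N m1 m2 +
       ((k1 + k2) / idot \<epsilon> (N1 m1 m2 + N2 m1 m2) (N1 m1 m2 + N2 m1 m2))
         *\<^sub>R (N1 m1 m2 + N2 m1 m2)"
  have UV: "U m1 + V m2 \<noteq> 0" for m1 m2 using assms(2)[of m1 m2] by simp
  have low: "lower_transform \<epsilon> U V k2 N1 ?C"
    by (rule be_transform_superposition[OF _ UV assms(4,5,6)]) simp
  \<comment> \<open>With \<open>s = -1\<close> the lower-sign transform \<open>N2\<close> takes the
    first place; commutativity of addition restores the formula \<open>?C\<close>.\<close>
  have "be_transform (- (- 1)) \<epsilon> U V k1 N2 (\<lambda>m1 m2. - N m1 m2 +
       ((k2 + k1) / idot \<epsilon> (N2 m1 m2 + N1 m1 m2) (N2 m1 m2 + N1 m1 m2))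
         *\<^sub>R (N2 m1 m2 + N1 m1 m2))"
    by (rule be_transform_superposition[OF _ UV assms(5)])
      (use assms(4,6) in \<open>simp_all add: add.commute\<close>)
  hence up: "upper_transform \<epsilon> U V k1 N2 ?C"
    by (simp add: add.commute)
  have "bianchi_ernst \<epsilon> U V ?C" using low unfolding be_transform_def by blast
  \<comment> \<open>Uniqueness is immediate, as the explicit formula fixes every value of
    \<open>N12\<close>.\<close>
  with low up show ?thesis by (intro ex1I[of _ ?C]) (auto intro!: ext)
qed

end
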